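(* Let $s\geq 2$ be a fixed natural number. There exists a function $f:[0,1)\to[0,1)$ that preserves the digit frequencies (of the $s$-adic representation) and does not preserve the Hausdorff–Besicovitch dimension, i.e. there is a Borel set $E\subseteq[0,1)$ such that the Hausdorff–Besicovitch dimension of $f(E)$ is different from the Hausdorff–Besicovitch dimension of $E$.
   Context: Let $\mathcal{A}_s=\{0,1,\ldots,s-1\}$. Every $x\in[0,1)$ is written as $x=\sum_{k\ge1}\alpha_k(x)s^{-k}=\Delta^s_{\alpha_1(x)\alpha_2(x)\ldots}$ with $\alpha_k(x)\in\mathcal{A}_s$; for numbers with two such representations the one ending in period $(0)$ is used (never the one ending in period $(s-1)$), so $\alpha_k(x)$ is well defined. For $i\in\mathcal{A}_s$ put $N_i(x,n)=\#\{j\le n:\alpha_j(x)=i\}$; the frequency of the digit $i$ is $\nu_i(x)=\lim_{n\to\infty}N_i(x,n)/n$, if the limit exists. Let $\Theta$ be the set of $x\in[0,1)$ for which all the frequencies $\nu_0(x),\ldots,\nu_{s-1}(x)$ exist. A function $f:[0,1)\to[0,1)$ preserves the digit frequencies if (i) $\nu_i(f(x))=\nu_i(x)$ for all $i\in\mathcal{A}_s$ and all $x\in\Theta$; and (ii) for $x\in[0,1)\setminus\Theta$ the frequencies $\nu_i(x)$ and $\nu_i(f(x))$ do not exist simultaneously, meaning that for each $i\in\mathcal{A}_s$, $\nu_i(x)$ fails to exist if and only if $\nu_i(f(x))$ fails to exist. A function preserves the Hausdorff–Besicovitch (fractal) dimension if $E$ and $f(E)$ have equal Hausdorff dimension for every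 Borel set $E$. *)

theory Defs
  imports "HOL-Analysis.Analysis"
begin

section \<open>The \<open>s\<close>-adic representation\<close>

text \<open>
  Digit sequences are indexed from 0: the entry with index \<open>k\<close> is the mathematical digit
  \<open>\<alpha>\<^sub>k\<^sub>+\<^sub>1(x)\<close>, of weight \<open>s\<^sup>-\<^sup>(\<^sup>k\<^sup>+\<^sup>1\<^sup>)\<close>. The second conjunct excludes the period \<open>(s - 1)\<close>.
\<close>

definition is_expansion :: "nat \<Rightarrow> (nat \<Rightarrow> nat) \<Rightarrow> real \<Rightarrow> bool" where
  "is_expansion s a x \<longleftrightarrow>
     (\<forall>k. a k < s) \<and> \<not> (\<exists>m. \<forall>k\<ge>m. a k = s - 1) \<and>
     (\<lambda>k. real (a k) / real s ^ Suc k) sums x"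

definition digit :: "nat \<Rightarrow> real \<Rightarrow> nat \<Rightarrow> nat" where
  "digit s x = (THE a. is_expansion s a x)"

text \<open>The description in \<^const>\<open>digit\<close> is meaningful on the whole of \<open>[0,1)\<close>.\<close>

lemma is_expansion_less_one:
  assumes s: "s \<ge> 2" and a: "is_expansion s a x"
  shows "0 \<le> x" "x < 1"
proof -
  have sums: "(\<lambda>k. real (a k) / real s ^ Suc k) sums x" and lt: "\<And>k. a k < s"
    using a by (auto simp: is_expansion_def)
  show "0 \<le> x"
    by (rule sums_le[OF _ sums_zero sums]) simp
  have "(\<lambda>k. (1 / real s) ^ k) sums (1 / (1 - 1 / real s))"
    by (rule geometric_sums) (use s in simp)
  from sums_mult[OF this, of "(real s - 1) / real s"]
  have one: "(\<lambda>k. (real s - 1) / real s ^ Suc k) sums 1"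
    using s by (simp add: field_simps power_divide)
  have d: "(\<lambda>k. (real s - 1) / real s ^ Suc k - real (a k) / real s ^ Suc k) sums (1 - x)"
    by (rule sums_diff[OF one sums])
  obtain k where k: "a k \<noteq> s - 1"
    using a by (auto simp: is_expansion_def)
  have "real (a k) < real s - 1"
    using k lt[of k] s by linarith
  have "0 < (\<Sum>k. (real s - 1) / real s ^ Suc k - real (a k) / real s ^ Suc k)"
  proof (rule suminf_pos2[of _ k])
    show "summable (\<lambda>k. (real s - 1) / real s ^ Suc k - real (a k) / real s ^ Suc k)"
      using d by (rule sums_summable)
    show "0 \<le> (real s - 1) / real s ^ Suc n - real (a n) / real s ^ Suc n" for n
    proof -
      have "real (a n) \<le> real s - 1" using lt[of n] by linarith
      then show ?thesis using s by (simp add: divide_right_mono)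
    qed
    show "0 < (real s - 1) / real s ^ Suc k - real (a k) / real s ^ Suc k"
      using \<open>real (a k) < real s - 1\<close> s by (simp add: divide_strict_right_mono)
  qed
  then show "x < 1"
    using sums_unique[OF d] by simp
qed

lemma is_expansion_shift:
  assumes s: "s \<ge> 2" and a: "is_expansion s a x"
  shows "is_expansion s (\<lambda>k. a (Suc k)) (real s * x - real (a 0))"
proof -
  have sums: "(\<lambda>k. real (a k) / real s ^ Suc k) sums x"
    using a by (auto simp: is_expansion_def)
  from sums have "(\<lambda>k. real (a (Suc k)) / real s ^ Suc (Suc k)) sums (x - real (a 0) / real s)"
    using sums_Suc_iff[of "\<lambda>k. real (a k) / real s ^ Suc k"] by simp
  from sums_mult[OF this, of "real s"]
  have "(\<lambda>k. real (a (Suc k)) / real s ^ Suc k) sums (real s * x - real (a 0))"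
    using s by (simp add: right_diff_distrib)
  moreover have "\<not> (\<exists>m. \<forall>k\<ge>m. a (Suc k) = s - 1)"
  proof
    assume "\<exists>m. \<forall>k\<ge>m. a (Suc k) = s - 1"
    then obtain m where m: "\<And>k. k \<ge> m \<Longrightarrow> a (Suc k) = s - 1" by blast
    have "\<forall>k\<ge>Suc m. a k = s - 1"
    proof (intro allI impI)
      fix k assume "k \<ge> Suc m"
      then show "a k = s - 1" using m[of "k - 1"] by (cases k) auto
    qed
    then show False using a by (auto simp: is_expansion_def)
  qed
  ultimately show ?thesis
    using a by (auto simp: is_expansion_def)
qed

lemma is_expansion_unique:
  assumes s: "s \<ge> 2" and "is_expansion s a x" "is_expansion s b x"
  shows "a = b"
proof
  have first: "a 0 = b 0" if a: "is_expansion s a x" and b: "is_expansion s b x" for a b x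
  proof -
    have "real (a 0) \<le> real s * x" "real s * x < real (a 0) + 1"
      "real (b 0) \<le> real s * x" "real s * x < real (b 0) + 1"
      using is_expansion_less_one[OF s is_expansion_shift[OF s a]]
        is_expansion_less_one[OF s is_expansion_shift[OF s b]] by auto
    then show ?thesis by linarith
  qed
  show "a k = b k" for k
    using assms(2,3)
  proof (induction k arbitrary: a b x)
    case 0
    then show ?case using first by blast
  next
    case (Suc k)
    have "is_expansion s (\<lambda>k. b (Suc k)) (real s * x - real (a 0))"
      using is_expansion_shift[OF s Suc.prems(2)] first[OF Suc.prems] by simp
    with Suc.IH[OF is_expansion_shift[OF s Suc.prems(1)]] show ?case by blast
  qed
qed

lemma is_expansion_floor:
  assumes s: "s \<ge> 2" and x: "0 \<le> x" "x < 1"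
  shows "is_expansion s (\<lambda>k. nat (\<lfloor>x * real s ^ Suc k\<rfloor> mod int s)) x"
proof -
  define F where "F k = \<lfloor>x * real s ^ k\<rfloor>" for k
  define a where "a k = nat (F (Suc k) mod int s)" for k
  have F0: "F 0 = 0" using x by (simp add: F_def floor_eq_iff)
  have divF: "F (Suc k) div int s = F k" for k
  proof -
    have "F (Suc k) div int s = \<lfloor>x * real s ^ Suc k / real_of_int (int s)\<rfloor>"
      unfolding F_def by (rule floor_divide_real_eq_div[symmetric]) simp
    also have "\<dots> = F k" using s by (simp add: F_def)
    finally show ?thesis .
  qed
  have int_a: "int (a k) = F (Suc k) - int s * F k" for k
    using div_mult_mod_eq[of "F (Suc k)" "int s"] s
    by (simp add: a_def divF algebra_simps)
  have real_a: "real (a k) = real_of_int (F (Suc k)) - real s * real_of_int (F k)" for k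
    using arg_cong[OF int_a[of k], of real_of_int] by simp
  have lt: "a k < s" for k
    using s by (simp add: a_def nat_less_iff)
  have part: "(\<Sum>k<n. real (a k) / real s ^ Suc k) = real_of_int (F n) / real s ^ n" for n
    by (induction n) (use s in \<open>simp_all add: F0 real_a field_simps\<close>)
  have fl: "real_of_int (F n) \<le> x * real s ^ n" "x * real s ^ n < real_of_int (F n) + 1" for n
    unfolding F_def by linarith+
  have pw: "(\<lambda>n. (1 / real s) ^ n) \<longlonglongrightarrow> 0"
    by (rule LIMSEQ_power_zero) (use s in simp)
  have "(\<lambda>n. real_of_int (F n) / real s ^ n) \<longlonglongrightarrow> x"
  proof (rule tendsto_sandwich)
    show "\<forall>\<^sub>F n in sequentially. x - (1 / real s) ^ n \<le> real_of_int (F n) / real s ^ n"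
    proof (rule always_eventually, rule allI)
      fix n
      have "x * real s ^ n - 1 \<le> real_of_int (F n)" using fl(2)[of n] by simp
      then have "(x * real s ^ n - 1) / real s ^ n \<le> real_of_int (F n) / real s ^ n"
        by (rule divide_right_mono) simp
      then show "x - (1 / real s) ^ n \<le> real_of_int (F n) / real s ^ n"
        using s by (simp add: diff_divide_distrib power_divide)
    qed
    show "\<forall>\<^sub>F n in sequentially. real_of_int (F n) / real s ^ n \<le> x"
      using fl(1) s by (simp add: field_simps)
    show "(\<lambda>n. x - (1 / real s) ^ n) \<longlonglongrightarrow> x"
      using tendsto_diff[OF tendsto_const pw, of x] by simp
  qed simp
  then have sums: "(\<lambda>k. real (a k) / real s ^ Suc k) sums x"
    by (simp add: sums_def part del: power_Suc)
  have "\<not> (\<exists>m. \<forall>k\<ge>m. a k = s - 1)"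
  proof
    assume "\<exists>m. \<forall>k\<ge>m. a k = s - 1"
    then obtain m where m: "\<And>k. k \<ge> m \<Longrightarrow> a k = s - 1" by blast
    have step: "real_of_int (F (m + j)) + 1 = real s ^ j * (real_of_int (F m) + 1)" for j
    proof (induction j)
      case (Suc j)
      have "real_of_int (F (Suc (m + j))) + 1 = real s * (real_of_int (F (m + j)) + 1)"
        using real_a[of "m + j"] m[of "m + j"] s by (simp add: algebra_simps of_nat_diff)
      then show ?case using Suc by simp
    qed simp
    have "real_of_int (F m) + 1 - (1 / real s) ^ j \<le> x * real s ^ m" for j
    proof -
      have "real s ^ j * (real_of_int (F m) + 1) - 1 \<le> real s ^ j * (x * real s ^ m)"
        using fl(1)[of "m + j"] step[of j] by (simp add: power_add algebra_simps)
      then show ?thesis using s by (simp add: field_simps power_divide)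
    qed
    moreover have "(\<lambda>j. real_of_int (F m) + 1 - (1 / real s) ^ j) \<longlonglongrightarrow> real_of_int (F m) + 1"
      using tendsto_diff[OF tendsto_const pw, of "real_of_int (F m) + 1"] by simp
    ultimately have "real_of_int (F m) + 1 \<le> x * real s ^ m"
      by (intro LIMSEQ_le_const2) auto
    then show False using fl(2)[of m] by simp
  qed
  with lt sums show ?thesis
    by (simp add: is_expansion_def a_def F_def)
qed

lemma is_expansion_digit:
  assumes "s \<ge> 2" "0 \<le> x" "x < 1"
  shows "is_expansion s (digit s x) x"
  unfolding digit_def
  by (rule theI[where P = "\<lambda>a. is_expansion s a x"], rule is_expansion_floor[OF assms])
    (rule is_expansion_unique[OF assms(1) _ is_expansion_floor[OF assms]])

lemma digit_eq_floor:
  assumes "s \<ge> 2" "0 \<le> x" "x < 1"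
  shows "digit s x k = nat (\<lfloor>x * real s ^ Suc k\<rfloor> mod int s)"
  using is_expansion_unique[OF assms(1) is_expansion_digit[OF assms] is_expansion_floor[OF assms]]
  by simp


section \<open>Digit frequencies\<close>

definition digit_count :: "nat \<Rightarrow> nat \<Rightarrow> real \<Rightarrow> nat \<Rightarrow> nat" where
  "digit_count s i x n = card {j. j < n \<and> digit s x j = i}"

definition has_freq :: "nat \<Rightarrow> nat \<Rightarrow> real \<Rightarrow> bool" where
  "has_freq s i x \<longleftrightarrow> convergent (\<lambda>n. real (digit_count s i x n) / real n)"

text \<open>Only meaningful where \<^const>\<open>has_freq\<close> holds.\<close>

definition freq :: "nat \<Rightarrow> nat \<Rightarrow> real \<Rightarrow> real" where
  "freq s i x = lim (\<lambda>n. real (digit_count s i x n) / real n)"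

definition Theta :: "nat \<Rightarrow> real set" where
  "Theta s = {x \<in> {0..<1}. \<forall>i<s. has_freq s i x}"

definition preserves_digit_frequencies :: "nat \<Rightarrow> (real \<Rightarrow> real) \<Rightarrow> bool" where
  "preserves_digit_frequencies s f \<longleftrightarrow>
     (\<forall>x\<in>Theta s. \<forall>i<s. has_freq s i (f x) \<and> freq s i (f x) = freq s i x) \<and>
     (\<forall>x\<in>{0..<1} - Theta s. \<forall>i<s. \<not> has_freq s i x \<longleftrightarrow> \<not> has_freq s i (f x))"


section \<open>Hausdorff--Besicovitch dimension\<close>

text \<open>
  The case distinction realises the conventions \<open>diam({})\<^sup>d = 0\<close> and \<open>t\<^sup>0 = 1\<close> for \<open>t \<ge> 0\<close>, so that
  exponent 0 gives counting measure; in contrast \<^term>\<open>0 powr 0 = (0::real)\<close>.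
\<close>

definition diam_pow :: "real \<Rightarrow> 'a::metric_space set \<Rightarrow> ennreal" where
  "diam_pow d U = (if U = {} then 0 else if d = 0 then 1 else ennreal (diameter U powr d))"

text \<open>Boundedness is required because \<^const>\<open>diameter\<close> is unspecified on unbounded sets.\<close>

definition hausdorff_premeasure :: "real \<Rightarrow> real \<Rightarrow> 'a::metric_space set \<Rightarrow> ennreal" where
  "hausdorff_premeasure d \<delta> E =
     (INF U \<in> {U :: nat \<Rightarrow> 'a set. E \<subseteq> (\<Union>i. U i) \<and> (\<forall>i. bounded (U i) \<and> diameter (U i) \<le> \<delta>)}.
        (\<Sum>i. diam_pow d (U i)))"

definition hausdorff_measure :: "real \<Rightarrow> 'a::metric_space set \<Rightarrow> ennreal" where
  "hausdorff_measure d E = (SUP \<delta> \<in> {0<..}. hausdorff_premeasure d \<delta> E)"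

definition hausdorff_dim :: "'a::metric_space set \<Rightarrow> ereal" where
  "hausdorff_dim E = Inf {ereal d | d. 0 \<le> d \<and> hausdorff_measure d E = 0}"

end

(*
  Let E consist of the numbers whose expansion is a concatenation of the blocks 01 and 10. All of E
  has the same digit frequencies, so the map that collapses E to one of its points and fixes every
  other number preserves them, and it sends E to a set of dimension 0. Reading the block 01 as the
  binary digit 0 and 10 as the binary digit 1 gives a map of E onto [0,1) which is Hoelder
  continuous with exponent ln 2 / (2 ln s); hence the dimension of E is at least this exponent.
*)
theory Submission
  imports Defs
begin

section \<open>Bounds for the Hausdorff dimension\<close>

text \<open>Here \<open>\<phi>\<close> is a right inverse of the Hoelder map from part of
  \<open>E\<close> onto the unit interval. A cover of \<open>E\<close> pulls back along
  \<open>\<phi>\<close> to a cover of the interval, and a set of diameter \<open>r\<close> pulls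
  back into an interval of length \<open>2 * C * r powr \<alpha>\<close>. The lengths sum to at
  least 1, so the cover cannot be cheap.\<close>

lemma hausdorff_dim_ge_if_Hoelder_onto_interval:
  fixes \<phi> :: "real \<Rightarrow> 'a::metric_space"
  assumes C: "0 < C" and \<alpha>: "0 < \<alpha>"
    and \<phi>: "\<phi> ` {0..<1} \<subseteq> E"
    and hoelder: "\<And>t u. t \<in> {0..<1} \<Longrightarrow> u \<in> {0..<1} \<Longrightarrow>
                    \<bar>t - u\<bar> \<le> C * dist (\<phi> t) (\<phi> u) powr \<alpha>"
  shows "ereal \<alpha> \<le> hausdorff_dim E"
proof -
  have pos: "hausdorff_measure d E \<noteq> 0" if d: "0 \<le> d" "d \<le> \<alpha>" for d
  proof -
    \<comment> \<open>The measure is a supremum over meshes, so mesh 1 is enough for positivity.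
      With diameters at most 1, lowering the exponent from \<open>\<alpha>\<close> to
      \<open>d\<close> can only increase the terms.\<close>
    have "ennreal (1 / (2 * C)) \<le> (\<Sum>i. diam_pow d (U i))"
      if U: "E \<subseteq> (\<Union>i. U i)" "\<And>i. bounded (U i)" "\<And>i. diameter (U i) \<le> 1"
      for U :: "nat \<Rightarrow> 'a set"
    proof -
      define V where "V i = {t \<in> {0..<1}. \<phi> t \<in> U i}" for i
      \<comment> \<open>The preimage \<open>V i\<close> may fail to be measurable, so it is enclosed
        in an interval centred at any one of its points.\<close>
      have "\<exists>K\<in>sets lborel. V i \<subseteq> K \<and> emeasure lborel K \<le> ennreal (2 * C) * diam_pow d (U i)" for i
      proof (cases "V i = {}")
        case True
        then show ?thesis by (intro bexI[of _ "{}"]) auto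
      next
        case False
        then obtain t where t: "t \<in> V i" by auto
        define r where "r = C * diameter (U i) powr \<alpha>"
        have "r \<ge> 0" using C by (simp add: r_def)
        have "V i \<subseteq> {t - r..t + r}"
        proof
          fix u assume u: "u \<in> V i"
          have "dist (\<phi> t) (\<phi> u) \<le> diameter (U i)"
            using t u by (intro diameter_bounded_bound U) (auto simp: V_def)
          then have "dist (\<phi> t) (\<phi> u) powr \<alpha> \<le> diameter (U i) powr \<alpha>"
            using \<alpha> by (intro powr_mono2) auto
          then have "\<bar>t - u\<bar> \<le> r"
            using hoelder[of t u] t u C unfolding r_def
            by (auto simp: V_def intro: order_trans mult_left_mono)
          then show "u \<in> {t - r..t + r}" by (auto simp: abs_le_iff)
        qed
        moreover have "emeasure lborel {t - r..t + r} = ennreal (2 * C) * ennreal (diameter (U i) powr \<alpha>)"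
          using \<open>r \<ge> 0\<close> C by (simp add: r_def ennreal_mult[symmetric] mult.assoc)
        moreover have "ennreal (diameter (U i) powr \<alpha>) \<le> diam_pow d (U i)"
        proof -
          have "U i \<noteq> {}" using t by (auto simp: V_def)
          have ge0: "0 \<le> diameter (U i)" by (rule diameter_ge_0[OF U(2)])
          show ?thesis
          \<comment> \<open>With exponent 0 a nonempty set contributes 1 by convention, even if its
            diameter is 0.\<close>
          proof (cases "d = 0")
            case True
            have "diameter (U i) powr \<alpha> \<le> 1"
              using ge0 U(3)[of i] \<alpha> by (intro powr_le1) auto
            with True \<open>U i \<noteq> {}\<close> show ?thesis by (simp add: diam_pow_def)
          next
            case False
            have "diameter (U i) powr \<alpha> \<le> diameter (U i) powr d"
              using ge0 U(3)[of i] d by (intro powr_mono') auto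
            with False \<open>U i \<noteq> {}\<close> show ?thesis by (simp add: diam_pow_def ennreal_leI)
          qed
        qed
        ultimately show ?thesis
          by (intro bexI[of _ "{t - r..t + r}"]) (auto intro: mult_left_mono)
      qed
      then obtain K where K: "\<And>i. K i \<in> sets lborel" "\<And>i. V i \<subseteq> K i"
        "\<And>i. emeasure lborel (K i) \<le> ennreal (2 * C) * diam_pow d (U i)"
        by metis
      have "{0..<1} \<subseteq> (\<Union>i. V i)" using U(1) \<phi> by (fastforce simp: V_def)
      also have "\<dots> \<subseteq> (\<Union>i. K i)" using K(2) by blast
      finally have "{0..<1} \<subseteq> (\<Union>i. K i)" .
      then have "emeasure lborel {0..<1::real} \<le> emeasure lborel (\<Union>i. K i)"
        using K(1) by (intro emeasure_mono) auto
      also have "\<dots> \<le> (\<Sum>i. emeasure lborel (K i))"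
        using K(1) by (intro emeasure_subadditive_countably) auto
      also have "\<dots> \<le> (\<Sum>i. ennreal (2 * C) * diam_pow d (U i))"
        by (intro suminf_le K(3)) auto
      also have "\<dots> = ennreal (2 * C) * (\<Sum>i. diam_pow d (U i))" by simp
      finally have "ennreal (1 / (2 * C)) * 1
          \<le> ennreal (1 / (2 * C)) * (ennreal (2 * C) * (\<Sum>i. diam_pow d (U i)))"
        by (intro mult_left_mono) simp_all
      also have "\<dots> = (\<Sum>i. diam_pow d (U i))"
        using C by (simp add: mult.assoc[symmetric] ennreal_mult[symmetric])
      finally show ?thesis by simp
    qed
    then have "ennreal (1 / (2 * C)) \<le> hausdorff_premeasure d 1 E"
      unfolding hausdorff_premeasure_def by (intro INF_greatest) auto
    also have "\<dots> \<le> hausdorff_measure d E"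
      unfolding hausdorff_measure_def by (intro SUP_upper) auto
    finally show ?thesis using C by (auto simp: ennreal_eq_0_iff)
  qed
  show ?thesis
    unfolding hausdorff_dim_def
  proof (rule Inf_greatest)
    fix z assume "z \<in> {ereal d | d. 0 \<le> d \<and> hausdorff_measure d E = 0}"
    then obtain d where "z = ereal d" "0 \<le> d" "hausdorff_measure d E = 0" by blast
    with pos[of d] show "ereal \<alpha> \<le> z" by force
  qed
qed

lemma hausdorff_dim_singleton_le:
  fixes p :: "'a::metric_space"
  assumes d: "0 < d"
  shows "hausdorff_dim {p} \<le> ereal d"
proof -
  have "hausdorff_premeasure d \<delta> {p} = 0" if "\<delta> > 0" for \<delta>
  proof -
    \<comment> \<open>The constant cover costs nothing: the diameter is 0 and \<open>d\<close> is
      positive, so every term is 0.\<close>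
    define U where "U = (\<lambda>i::nat. {p})"
    have "hausdorff_premeasure d \<delta> {p} \<le> (\<Sum>i. diam_pow d (U i))"
      unfolding hausdorff_premeasure_def using that
      by (intro INF_lower) (auto simp: U_def)
    also have "\<dots> = 0" using d by (simp add: U_def diam_pow_def)
    finally show ?thesis by simp
  qed
  then have "hausdorff_measure d {p} = 0" by (simp add: hausdorff_measure_def)
  then show ?thesis
    unfolding hausdorff_dim_def using d by (intro Inf_lower) auto
qed

section \<open>Balanced digit sequences and their frequencies\<close>

text \<open>The blocks 01 and 10 occupy the index pairs starting at even positions; the even entry
  names the block. It is 0 or 1, so the natural subtraction does not truncate.\<close>

definition balanced :: "(nat \<Rightarrow> nat) \<Rightarrow> bool" where
  "balanced a \<longleftrightarrow> (\<forall>k. a (2 * k) < 2 \<and> a (Suc (2 * k)) = 1 - a (2 * k))"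

lemma balanced_less_2:
  assumes "balanced a"
  shows "a n < 2"
proof (cases "even n")
  case True
  then obtain k where "n = 2 * k" by blast
  with assms show ?thesis by (simp add: balanced_def)
next
  case False
  then obtain k where "n = Suc (2 * k)" by (metis oddE Suc_eq_plus1)
  with assms show ?thesis by (simp add: balanced_def)
qed

lemma balanced_1: "balanced a \<Longrightarrow> a 1 = 1 - a 0"
  unfolding balanced_def by (metis One_nat_def mult_0_right)

lemma balanced_shift: "balanced a \<Longrightarrow> balanced (\<lambda>k. a (Suc (Suc k)))"
  unfolding balanced_def
proof
  fix k
  assume "\<forall>k. a (2 * k) < 2 \<and> a (Suc (2 * k)) = 1 - a (2 * k)"
  from this[rule_format, of "Suc k"]
  show "a (Suc (Suc (2 * k))) < 2 \<and> a (Suc (Suc (Suc (2 * k)))) = 1 - a (Suc (Suc (2 * k)))"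
    by simp
qed

text \<open>Either block contains one 0, one 1 and no other digit.\<close>

lemma balanced_card_even:
  assumes "balanced a"
  shows "card {j. j < 2 * m \<and> a j = i} = (if i < 2 then m else 0)"
proof (induction m)
  case (Suc m)
  have "{j. j < 2 * Suc m \<and> a j = i} =
      {j. j < 2 * m \<and> a j = i} \<union> {j \<in> {2 * m, Suc (2 * m)}. a j = i}"
    by (auto simp: less_Suc_eq)
  moreover have "card ({j. j < 2 * m \<and> a j = i} \<union> {j \<in> {2 * m, Suc (2 * m)}. a j = i})
      = card {j. j < 2 * m \<and> a j = i} + card {j \<in> {2 * m, Suc (2 * m)}. a j = i}"
    by (rule card_Un_disjoint) auto
  moreover have "card {j \<in> {2 * m, Suc (2 * m)}. a j = i} = (if i < 2 then 1 else 0)"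
  proof -
    have "a (2 * m) < 2" "a (Suc (2 * m)) = 1 - a (2 * m)"
      using assms by (auto simp: balanced_def)
    then have "a (2 * m) = 0 \<and> a (Suc (2 * m)) = 1 \<or> a (2 * m) = 1 \<and> a (Suc (2 * m)) = 0"
      by (auto simp: less_2_cases_iff)
    then have "{j \<in> {2 * m, Suc (2 * m)}. a j = i} =
        (if i < 2 then {if a (2 * m) = i then 2 * m else Suc (2 * m)} else {})"
      by auto
    then show ?thesis by simp
  qed
  ultimately show ?case using Suc by simp
qed simp

lemma balanced_digit_count_tendsto:
  assumes "balanced (digit s x)"
  shows "(\<lambda>n. real (digit_count s i x n) / real n) \<longlonglongrightarrow> (if i < 2 then 1 / 2 else 0)"
proof -
  define c :: nat where "c = (if i < 2 then 1 else 0)"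
  \<comment> \<open>The count up to \<open>n\<close> lies between the counts over the complete
    blocks inside the prefix and over one block more. These differ by at most 1, an error that
    vanishes after division by \<open>n\<close>.\<close>
  have bound: "\<bar>real (digit_count s i x n) - real n * real c / 2\<bar> \<le> 1" for n
  proof -
    define m where "m = n div 2"
    have n: "2 * m \<le> n" "n \<le> 2 * m + 1" by (auto simp: m_def)
    have count: "card {j. j < 2 * k \<and> digit s x j = i} = k * c" for k
      using balanced_card_even[OF assms, of k i] by (simp add: c_def)
    have "card {j. j < 2 * m \<and> digit s x j = i} \<le> digit_count s i x n"
      unfolding digit_count_def using n by (intro card_mono) auto
    moreover have "digit_count s i x n \<le> card {j. j < 2 * (m + 1) \<and> digit s x j = i}"
      unfolding digit_count_def using n by (intro card_mono) auto
    ultimately have "m * c \<le> digit_count s i x n" "digit_count s i x n \<le> (m + 1) * c"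
      by (simp_all only: count)
    then show ?thesis using n by (auto simp: c_def abs_le_iff split: if_splits)
  qed
  have "(\<lambda>n. real (digit_count s i x n) / real n) \<longlonglongrightarrow> real c / 2"
  proof (rule LIM_zero_cancel, rule Lim_null_comparison)
    show "\<forall>\<^sub>F n in sequentially. norm (real (digit_count s i x n) / real n - real c / 2) \<le> 1 / real n"
    proof (rule eventually_sequentiallyI)
      fix n :: nat assume "1 \<le> n"
      then have "real (digit_count s i x n) / real n - real c / 2
          = (real (digit_count s i x n) - real n * real c / 2) / real n"
        by (simp add: field_simps)
      then show "norm (real (digit_count s i x n) / real n - real c / 2) \<le> 1 / real n"
        using bound[of n] by (simp add: abs_divide divide_right_mono)
    qed
    show "(\<lambda>n. 1 / real n) \<longlonglongrightarrow> 0" by (rule lim_1_over_n)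
  qed
  then show ?thesis by (simp add: c_def split: if_splits)
qed

section \<open>The Hoelder estimate\<close>

text \<open>The first block, read as a two-digit number, is 1 or \<open>s\<close>, and the tail adds
  less than 1 to it. The bounds keep tails away from 0 and 1, which is what separates the two
  cylinders when \<open>s = 2\<close>, where they are adjacent.\<close>

lemma balanced_expansion_bounds:
  assumes s: "s \<ge> 2" and a: "is_expansion s a x" "balanced a"
  shows "1 / real s ^ 2 \<le> x" "x \<le> 1 / real s + 1 / real s ^ 2"
proof -
  have "is_expansion s (\<lambda>k. a (Suc (Suc k))) (real s * (real s * x - real (a 0)) - real (a 1))"
    using is_expansion_shift[OF s is_expansion_shift[OF s a(1)]] by simp
  from is_expansion_less_one[OF s this]
  have x: "real s * real (a 0) + real (a 1) \<le> real s ^ 2 * x"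
    "real s ^ 2 * x \<le> real s * real (a 0) + real (a 1) + 1"
    by (simp_all add: power2_eq_square algebra_simps)
  have "a 0 < 2" "a 1 = 1 - a 0"
    using balanced_less_2 balanced_1 a(2) by blast+
  then have "1 \<le> real s * real (a 0) + real (a 1)"
    "real s * real (a 0) + real (a 1) \<le> real s"
    using s by (auto simp: less_2_cases_iff)
  with x have "1 \<le> real s ^ 2 * x" "real s ^ 2 * x \<le> real s + 1" by linarith+
  then show "1 / real s ^ 2 \<le> x" "x \<le> 1 / real s + 1 / real s ^ 2"
    using s by (auto simp: field_simps power2_eq_square)
qed

lemma is_expansion_shift_2:
  assumes "s \<ge> 2" "is_expansion s a x"
  shows "is_expansion s (\<lambda>k. a (Suc (Suc k))) (real s ^ 2 * x - real s * real (a 0) - real (a 1))"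
  using is_expansion_shift[OF assms(1) is_expansion_shift[OF assms]]
  by (simp add: power2_eq_square algebra_simps)

text \<open>After scaling by the square of \<open>s\<close>, bounding both tails leaves a gap of at
  least \<open>s - 1 - 1 / s\<close>, and this is at least 1/2 for \<open>s \<ge> 2\<close>.\<close>

lemma balanced_separation:
  assumes s: "s \<ge> 2"
    and a: "is_expansion s a x" "balanced a" and b: "is_expansion s b y" "balanced b"
    and ab: "a 0 = 0" "b 0 = 1"
  shows "1 / (2 * real s ^ 2) \<le> y - x"
proof -
  have s0: "real s \<ge> 2" using s by simp
  have 1: "a 1 = 1" "b 1 = 0"
    using balanced_1[OF a(2)] balanced_1[OF b(2)] ab by simp_all
  have "is_expansion s (\<lambda>k. a (Suc (Suc k))) (real s ^ 2 * x - 1)"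
    "is_expansion s (\<lambda>k. b (Suc (Suc k))) (real s ^ 2 * y - real s)"
    using is_expansion_shift_2[OF s a(1)] is_expansion_shift_2[OF s b(1)] ab 1 by simp_all
  then have "real s ^ 2 * x - 1 \<le> 1 / real s + 1 / real s ^ 2"
    "1 / real s ^ 2 \<le> real s ^ 2 * y - real s"
    using balanced_expansion_bounds[OF s] balanced_shift a(2) b(2) by blast+
  moreover have "1 / real s \<le> 1 / 2" using s0 by (simp add: field_simps)
  ultimately have "1 / 2 \<le> real s ^ 2 * y - real s ^ 2 * x" using s0 by linarith
  then show ?thesis using s0 by (simp add: field_simps)
qed

text \<open>Removing a common first block multiplies the distance of \<open>x\<close> and
  \<open>y\<close> by the square of \<open>s\<close> and that of \<open>t\<close> and
  \<open>u\<close> by 2. The exponent is the one for which these factors match, so the inequality is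
  unchanged, and induction reduces to different first blocks.\<close>

lemma balanced_Hoelder:
  assumes s: "s \<ge> 2"
    and "is_expansion s a x" "balanced a" "is_expansion 2 (\<lambda>k. a (2 * k)) t"
    and "is_expansion s b y" "balanced b" "is_expansion 2 (\<lambda>k. b (2 * k)) u"
    and "a (2 * k) \<noteq> b (2 * k)"
  shows "\<bar>t - u\<bar> \<le> 4 * \<bar>x - y\<bar> powr (ln 2 / (2 * ln (real s)))"
  using assms(2-)
proof (induction k arbitrary: a b x y t u)
  have s0: "real s \<ge> 2" using s by simp
  define \<alpha> where "\<alpha> = ln 2 / (2 * ln (real s))"
  have "ln 2 \<le> ln (real s)" "0 < ln (real s)" using s0 by simp_all
  then have \<alpha>: "0 < \<alpha>" "\<alpha> \<le> 1" by (simp_all add: \<alpha>_def)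
  have pw: "(real s ^ 2) powr \<alpha> = 2"
    using s0 by (simp add: powr_def \<alpha>_def ln_realpow)
  \<comment> \<open>Serves the base case and also the inductive step when the first blocks already
    differ, since \<open>k\<close> need not be the first index of disagreement.\<close>
  have differ: "\<bar>t - u\<bar> \<le> 4 * \<bar>x - y\<bar> powr \<alpha>"
    if "is_expansion s a x" "balanced a" "is_expansion 2 (\<lambda>k. a (2 * k)) t"
      "is_expansion s b y" "balanced b" "is_expansion 2 (\<lambda>k. b (2 * k)) u" "a 0 \<noteq> b 0"
    for a b x y t u
  proof -
    have "a 0 < 2" "b 0 < 2" using that balanced_less_2 by blast+
    then have "a 0 = 0 \<and> b 0 = 1 \<or> b 0 = 0 \<and> a 0 = 1"
      using that(7) by auto
    then have "1 / (2 * real s ^ 2) \<le> \<bar>x - y\<bar>"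
      using balanced_separation[OF s, of a x b y] balanced_separation[OF s, of b y a x] that
      by fastforce
    then have "(1 / (2 * real s ^ 2)) powr \<alpha> \<le> \<bar>x - y\<bar> powr \<alpha>"
      using \<alpha> by (intro powr_mono2) auto
    moreover have "(1 / (2 * real s ^ 2)) powr \<alpha> = 1 / (2 powr \<alpha> * 2)"
      using s0 by (simp add: powr_divide powr_mult pw)
    \<comment> \<open>Source of the constant 4: as \<open>\<alpha> \<le> 1\<close>, the separation
      raised to \<open>\<alpha>\<close> is at least 1/4, while \<open>t\<close> and \<open>u\<close>
      are at distance at most 1.\<close>
    moreover have "2 powr \<alpha> \<le> 2 powr (1::real)" using \<alpha> by (intro powr_mono) auto
    then have "1 / 4 \<le> 1 / (2 powr \<alpha> * 2)" by (simp add: field_simps)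
    moreover have "\<bar>t - u\<bar> \<le> 1"
      using is_expansion_less_one[OF _ that(3)] is_expansion_less_one[OF _ that(6)] by auto
    ultimately show ?thesis by linarith
  qed
  {
    case 0
    then show ?case using differ[of a x t b y u] by (simp add: \<alpha>_def)
  next
    case (Suc k)
    show ?case
    proof (cases "a 0 = b 0")
      case False
      with Suc.prems show ?thesis using differ[of a x t b y u] by (simp add: \<alpha>_def)
    next
      case True
      \<comment> \<open>Equal first digits mean equal first blocks, so both expansions are shifted
        by the same amounts.\<close>
      have eq: "b 0 = a 0" "b 1 = a 1"
        using True balanced_1[OF Suc.prems(2)] balanced_1[OF Suc.prems(5)] by simp_all
      define x' where "x' = real s ^ 2 * x - real s * real (a 0) - real (a 1)"
      define y' where "y' = real s ^ 2 * y - real s * real (a 0) - real (a 1)"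
      define t' where "t' = 2 * t - real (a 0)"
      define u' where "u' = 2 * u - real (a 0)"
      have "\<bar>t' - u'\<bar> \<le> 4 * \<bar>x' - y'\<bar> powr (ln 2 / (2 * ln (real s)))"
      proof (rule Suc.IH)
        show "is_expansion s (\<lambda>k. a (Suc (Suc k))) x'" "is_expansion s (\<lambda>k. b (Suc (Suc k))) y'"
          using is_expansion_shift_2[OF s Suc.prems(1)] is_expansion_shift_2[OF s Suc.prems(4)] eq
          by (simp_all add: x'_def y'_def)
        show "is_expansion 2 (\<lambda>k. a (Suc (Suc (2 * k)))) t'"
          "is_expansion 2 (\<lambda>k. b (Suc (Suc (2 * k)))) u'"
          using is_expansion_shift[OF _ Suc.prems(3)] is_expansion_shift[OF _ Suc.prems(6)] eq
          by (simp_all add: t'_def u'_def)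
      qed (use Suc.prems balanced_shift in auto)
      moreover have "\<bar>t' - u'\<bar> = 2 * \<bar>t - u\<bar>" by (simp add: t'_def u'_def abs_if)
      moreover have "\<bar>x' - y'\<bar> = real s ^ 2 * \<bar>x - y\<bar>"
        by (simp add: x'_def y'_def abs_mult flip: right_diff_distrib)
      then have "\<bar>x' - y'\<bar> powr \<alpha> = 2 * \<bar>x - y\<bar> powr \<alpha>"
        by (simp add: powr_mult pw)
      ultimately show ?thesis unfolding \<alpha>_def[symmetric] by simp
    qed
  }
qed

section \<open>Numbers with prescribed blocks\<close>

lemma is_expansion_exists:
  assumes s: "s \<ge> 2" and a: "\<And>k. a k < s" "\<not> (\<exists>m. \<forall>k\<ge>m. a k = s - 1)"
  shows "\<exists>x. is_expansion s a x"
proof -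
  have "summable (\<lambda>k. (1 / real s) ^ k)"
    using s by (intro summable_geometric) simp
  then have "summable (\<lambda>k. real (a k) / real s ^ Suc k)"
  proof (rule summable_comparison_test')
    fix k :: nat
    have "real (a k) \<le> real s" using a(1)[of k] by simp
    then have "real (a k) / real s ^ Suc k \<le> real s / real s ^ Suc k"
      by (intro divide_right_mono) auto
    then show "norm (real (a k) / real s ^ Suc k) \<le> (1 / real s) ^ k"
      using s by (simp add: power_divide)
  qed
  with a show ?thesis unfolding is_expansion_def by (blast intro: summable_sums)
qed

lemma balanced_expansion_exists:
  assumes s: "s \<ge> 2" and b: "\<And>k. b k < (2 :: nat)"
  shows "\<exists>a x. is_expansion s a x \<and> balanced a \<and> (\<lambda>k. a (2 * k)) = b"
proof -
  define a where "a n = (if even n then b (n div 2) else 1 - b (n div 2))" for n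
  have bal: "balanced a" using b by (simp add: balanced_def a_def)
  \<comment> \<open>The two digits of a block are complementary, so they cannot both be
    \<open>s - 1\<close>. Hence \<open>b\<close> may be any binary sequence, even one ending in
    ones.\<close>
  have "\<not> (\<exists>m. \<forall>k\<ge>m. a k = s - 1)"
  proof
    assume "\<exists>m. \<forall>k\<ge>m. a k = s - 1"
    then obtain m where m: "\<And>k. k \<ge> m \<Longrightarrow> a k = s - 1" by blast
    have "a (2 * m) = s - 1" "a (Suc (2 * m)) = s - 1" by (rule m, simp)+
    moreover have "a (Suc (2 * m)) = 1 - a (2 * m)" using bal by (simp add: balanced_def)
    ultimately show False using s by simp
  qed
  moreover have "a k < s" for k using balanced_less_2[OF bal, of k] s by simp
  ultimately obtain x where "is_expansion s a x"
    using is_expansion_exists[OF s, of a] by blast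
  moreover have "(\<lambda>k. a (2 * k)) = b" by (simp add: a_def)
  ultimately show ?thesis using bal by blast
qed

section \<open>The set of balanced numbers: measurability and dimension\<close>

text \<open>This is the self-similar set of the two contractions that send \<open>x\<close> to
  \<open>(x + 1) / s^2\<close> and to \<open>(x + s) / s^2\<close>.\<close>

definition balanced_set :: "nat \<Rightarrow> real set" where
  "balanced_set s = {x \<in> {0..<1}. balanced (digit s x)}"

lemma balanced_set_borel:
  assumes s: "s \<ge> 2"
  shows "balanced_set s \<in> sets borel"
proof -
  \<comment> \<open>The floor formula is Borel on the whole line and agrees with
    \<open>digit\<close> on the unit interval. It turns membership into countably many conditions on
    measurable functions.\<close>
  define D where "D k x = nat (\<lfloor>x * real s ^ Suc k\<rfloor> mod int s)" for k x
  have [measurable]: "D k \<in> borel \<rightarrow>\<^sub>M count_space UNIV" for k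
    unfolding D_def by measurable
  have "balanced_set s =
      {x \<in> space borel. 0 \<le> x \<and> x < 1 \<and> 
        (\<forall>k. D (2 * k) x = 0 \<and> D (Suc (2 * k)) x = 1 \<or> D (2 * k) x = 1 \<and> D (Suc (2 * k)) x = 0)}"
  proof -
    have "balanced (digit s x) \<longleftrightarrow>
        (\<forall>k. D (2 * k) x = 0 \<and> D (Suc (2 * k)) x = 1 \<or> D (2 * k) x = 1 \<and> D (Suc (2 * k)) x = 0)"
      if "0 \<le> x" "x < 1" for x
    proof -
      have "digit s x k = D k x" for k
        unfolding D_def by (rule digit_eq_floor[OF s that])
      moreover have "p < 2 \<and> q = 1 - p \<longleftrightarrow> p = 0 \<and> q = 1 \<or> p = 1 \<and> q = 0" for p q :: nat
        by linarith
      ultimately show ?thesis unfolding balanced_def by simp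
    qed
    then show ?thesis unfolding balanced_set_def by (intro Collect_cong) (simp, blast)
  qed
  also have "\<dots> \<in> sets borel" by measurable
  finally show ?thesis .
qed

lemma hausdorff_dim_balanced_set:
  assumes s: "s \<ge> 2"
  shows "ereal (ln 2 / (2 * ln (real s))) \<le> hausdorff_dim (balanced_set s)"
proof -
  \<comment> \<open>The binary digits of \<open>t\<close> select the blocks of \<open>x\<close>;
    choosing such an \<open>x\<close> for each \<open>t\<close> gives the right inverse
    \<open>\<phi>\<close> of the reading map.\<close>
  have "\<exists>a x. is_expansion s a x \<and> balanced a \<and> is_expansion 2 (\<lambda>k. a (2 * k)) t"
    if "t \<in> {0..<1}" for t
  proof -
    have t: "is_expansion 2 (digit 2 t) t" using that by (intro is_expansion_digit) auto
    then have "digit 2 t k < 2" for k by (simp add: is_expansion_def)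
    from balanced_expansion_exists[of s "digit 2 t", OF s this] obtain a x
      where a: "is_expansion s a x" "balanced a" "(\<lambda>k. a (2 * k)) = digit 2 t" by blast
    have "is_expansion 2 (\<lambda>k. a (2 * k)) t" unfolding a(3) by (rule t)
    with a show ?thesis by blast
  qed
  then obtain a \<phi> where a: "\<And>t. t \<in> {0..<1} \<Longrightarrow> is_expansion s (a t) (\<phi> t)"
    "\<And>t. t \<in> {0..<1} \<Longrightarrow> balanced (a t)"
    "\<And>t. t \<in> {0..<1} \<Longrightarrow> is_expansion 2 (\<lambda>k. a t (2 * k)) t"
    by metis
  show ?thesis
  proof (rule hausdorff_dim_ge_if_Hoelder_onto_interval[of 4 _ \<phi>])
    show "0 < ln 2 / (2 * ln (real s))" using s by simp
    show "\<phi> ` {0..<1} \<subseteq> balanced_set s"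
    proof (rule image_subsetI)
      fix t :: real assume t: "t \<in> {0..<1}"
      have "0 \<le> \<phi> t" "\<phi> t < 1" using is_expansion_less_one[OF s a(1)[OF t]] by auto
      moreover from this have "digit s (\<phi> t) = a t"
        by (intro is_expansion_unique[OF s is_expansion_digit[OF s] a(1)[OF t]])
      ultimately show "\<phi> t \<in> balanced_set s" using a(2)[OF t] by (simp add: balanced_set_def)
    qed
    fix t u :: real assume tu: "t \<in> {0..<1}" "u \<in> {0..<1}"
    show "\<bar>t - u\<bar> \<le> 4 * dist (\<phi> t) (\<phi> u) powr (ln 2 / (2 * ln (real s)))"
    \<comment> \<open>If all blocks agree, then \<open>t\<close> and \<open>u\<close> have the same
      binary expansion and coincide; otherwise a differing block is an index for the Hoelder
      estimate.\<close>
    proof (cases "\<forall>k. a t (2 * k) = a u (2 * k)")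
      case True
      then have "t = u" using a(3)[OF tu(1)] a(3)[OF tu(2)]
        by (auto simp: is_expansion_def intro: sums_unique2)
      then show ?thesis by simp
    next
      case False
      then obtain k where "a t (2 * k) \<noteq> a u (2 * k)" by blast
      with balanced_Hoelder[OF s a[OF tu(1)] a[OF tu(2)]] show ?thesis
        by (simp add: dist_real_def)
    qed
  qed simp
qed

section \<open>The collapsing map\<close>

theorem theorem1:
  fixes s :: nat
  assumes "s \<ge> 2"
  shows "\<exists>f :: real \<Rightarrow> real.
           f \<in> {0..<1} \<rightarrow> {0..<1} \<and>
           preserves_digit_frequencies s f \<and>
           (\<exists>E \<in> sets borel. E \<subseteq> {0..<1} \<and> hausdorff_dim (f ` E) \<noteq> hausdorff_dim E)"
proof -
  define E where "E = balanced_set s"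
  \<comment> \<open>The zero sequence selects the block 01 throughout; of the resulting point only
    balancedness is used.\<close>
  obtain a p where "is_expansion s a p" "balanced a"
    using balanced_expansion_exists[OF assms, of "\<lambda>_. 0"] by auto
  moreover from this have "0 \<le> p" "p < 1" using is_expansion_less_one[OF assms] by auto
  ultimately have p: "p \<in> E"
    using is_expansion_unique[OF assms is_expansion_digit[OF assms]]
    by (auto simp: E_def balanced_set_def)
  define f where "f x = (if x \<in> E then p else x)" for x
  have lim: "(\<lambda>n. real (digit_count s i x n) / real n) \<longlonglongrightarrow> (if i < 2 then 1 / 2 else 0)"
    if "x \<in> E" for i x
    using that balanced_digit_count_tendsto by (simp add: E_def balanced_set_def)
  have "has_freq s i x" "freq s i x = (if i < 2 then 1 / 2 else 0)" if "x \<in> E" for i x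
    unfolding has_freq_def freq_def using lim[OF that] by (blast intro: convergentI limI)+
  \<comment> \<open>On \<open>E\<close> the limits are the same at \<open>x\<close> and at
    \<open>p\<close>; elsewhere \<open>f\<close> is the identity. As this holds for every
    \<open>x\<close>, it yields both conditions on frequencies.\<close>
  then have "has_freq s i (f x) = has_freq s i x" "freq s i (f x) = freq s i x" for i x
    using p by (auto simp: f_def)
  then have "preserves_digit_frequencies s f"
    by (auto simp: preserves_digit_frequencies_def Theta_def)
  moreover have E01: "E \<subseteq> {0..<1}" by (auto simp: E_def balanced_set_def)
  then have "f \<in> {0..<1} \<rightarrow> {0..<1}" using p by (auto simp: f_def)
  moreover have "hausdorff_dim (f ` E) \<noteq> hausdorff_dim E"
  proof -
    define \<alpha> where "\<alpha> = ln 2 / (2 * ln (real s))"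
    have "\<alpha> > 0" using assms by (simp add: \<alpha>_def)
    have "f ` E = {p}" using p by (auto simp: f_def)
    \<comment> \<open>Any positive exponent below \<open>\<alpha>\<close> separates the two
      dimensions; half of it is taken.\<close>
    then have "hausdorff_dim (f ` E) \<le> ereal (\<alpha> / 2)"
      using hausdorff_dim_singleton_le[of "\<alpha> / 2" p] \<open>\<alpha> > 0\<close> by simp
    also have "\<dots> < ereal \<alpha>" using \<open>\<alpha> > 0\<close> by simp
    also have "\<dots> \<le> hausdorff_dim E"
      using hausdorff_dim_balanced_set[OF assms] by (simp add: E_def \<alpha>_def)
    finally show ?thesis by simp
  qed
  moreover have "E \<in> sets borel" using balanced_set_borel[OF assms] by (simp add: E_def)
  ultimately show ?thesis using E01 by blast
qed

end
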